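(* Let $T\subset\mathbb{R}^3$ be a tetrahedron and let $F$ be a face of $T$ with edges $e_1,e_2,e_3$. Then $T$ is a height function relative to the foundation $F$ if and only if the dihedral angles of $T$ along the edges $e_1,e_2,e_3$ of $F$ are all not obtuse.
   Context: A tetrahedron is the convex hull of four affinely independent points of $\mathbb{R}^3$; its faces are its four triangles. $T$ is a height function relative to the foundation $F$ (where $F$ is a face of $T$) if the orthogonal projection $\pi_F:\mathbb{R}^3\to\operatorname{aff}(F)$ onto the affine plane containing $F$ satisfies $\pi_F(T)\subseteq F$. The dihedral angle of $T$ at an edge is the interior angle, in $(0,\pi)$, between the two faces of $T$ containing that edge; it is obtuse if it is greater than $\pi/2$. *)

theory Defs
  imports "HOL-Analysis.Analysis"
begin

definition orth_proj :: "'a::euclidean_space set \<Rightarrow> 'a \<Rightarrow> 'a" where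
  "orth_proj A x = (THE y. y \<in> A \<and> (\<forall>u\<in>A. \<forall>v\<in>A. orthogonal (x - y) (u - v)))"

definition is_height_function :: "(real ^ 3) set \<Rightarrow> (real ^ 3) set \<Rightarrow> bool" where
  "is_height_function T F \<longleftrightarrow> F facet_of T \<and> orth_proj (affine hull F) ` T \<subseteq> F"

(* The unit vector in the plane of the triangle G that is perpendicular to the edge e of G and
   points from e into G. *)
definition inward_normal :: "(real ^ 3) set \<Rightarrow> (real ^ 3) set \<Rightarrow> real ^ 3" where
  "inward_normal G e = (THE u. norm u = 1 \<and> (\<forall>x\<in>e. \<forall>y\<in>e. orthogonal u (x - y)) \<and>
                              (\<exists>x\<in>e. \<exists>t>0. x + t *\<^sub>R u \<in> G))"

(* The angle, measured in the plane perpendicular to e, between the half-planes bounded by the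
   line of e that contain the two facets G, H of T meeting in e; these are unique up to order. *)
definition dihedral_angle :: "(real ^ 3) set \<Rightarrow> (real ^ 3) set \<Rightarrow> real" where
  "dihedral_angle T e = (THE \<theta>. \<exists>G H. G facet_of T \<and> H facet_of T \<and> G \<noteq> H \<and> e \<subseteq> G \<and> e \<subseteq> H \<and>
                              \<theta> = arccos (inward_normal G e \<bullet> inward_normal H e))"

definition obtuse :: "real \<Rightarrow> bool" where
  "obtuse \<theta> \<longleftrightarrow> \<theta> > pi / 2"

lemma orth_proj_unique:
  fixes A :: "'a::euclidean_space set"
  assumes "y \<in> A" and "\<And>u v. u \<in> A \<Longrightarrow> v \<in> A \<Longrightarrow> orthogonal (x - y) (u - v)"
  shows "orth_proj A x = y"
  unfolding orth_proj_def
proof (rule the_equality)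
  show "y \<in> A \<and> (\<forall>u\<in>A. \<forall>v\<in>A. orthogonal (x - y) (u - v))"
    using assms by blast
  fix z assume z: "z \<in> A \<and> (\<forall>u\<in>A. \<forall>v\<in>A. orthogonal (x - z) (u - v))"
  then have "(x - z) \<bullet> (y - z) = 0" "(x - y) \<bullet> (y - z) = 0"
    using assms by (auto simp: orthogonal_def)
  then have "((x - z) - (x - y)) \<bullet> (y - z) = 0"
    by (simp only: inner_diff_left)
  then show "z = y" by simp
qed

lemma inward_normal_triangle:
  fixes a b c :: "real ^ 3"
  assumes nc: "\<not> collinear {a, b, c}"
    and w_def: "w = (c - a) - (((c - a) \<bullet> (b - a)) / ((b - a) \<bullet> (b - a))) *\<^sub>R (b - a)"
  shows "inward_normal (convex hull {a, b, c}) (closed_segment a b) = w /\<^sub>R norm w"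
proof -
  define l where "l = ((c - a) \<bullet> (b - a)) / ((b - a) \<bullet> (b - a))"
  have ab: "a \<noteq> b" using nc by auto
  have wl: "c - a = w + l *\<^sub>R (b - a)" by (simp add: w_def l_def)
  have orth: "w \<bullet> (b - a) = 0" 
  proof -
    have "(b - a) \<bullet> (b - a) \<noteq> 0" using ab by simp
    then show ?thesis by (simp add: w_def inner_diff_left[of "c - a" "_ *\<^sub>R (b - a)"])
  qed
  have w0: "w \<noteq> 0"
  proof
    assume "w = 0"
    then have "c = a + l *\<^sub>R (b - a)" using wl by (simp add: algebra_simps)
    then have "c \<in> affine hull {a, b}"
      unfolding affine_hull_2
      by (intro CollectI exI[of _ "1 - l"] exI[of _ l]) (simp add: algebra_simps)
    then have "collinear {a, b, c}"
      by (metis ab collinear_3_affine_hull)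
    with nc show False by simp
  qed
  let ?u = "w /\<^sub>R norm w"
  have seg: "\<exists>s. x = a + s *\<^sub>R (b - a)" if "x \<in> closed_segment a b" for x
    using that by (auto simp: in_segment algebra_simps)
  have hull: "convex hull {a, b, c}
      = {a + p *\<^sub>R (b - a) + q *\<^sub>R (c - a) | p q. 0 \<le> p \<and> 0 \<le> q \<and> p + q \<le> 1}"
    by (rule convex_hull_3_alt)
  show ?thesis unfolding inward_normal_def
  proof (rule the_equality)
    define t where "t = 1 / (2 * (1 + \<bar>l\<bar>))"
    have t: "t > 0" "t * (1 + \<bar>l\<bar>) = 1/2" by (auto simp: t_def add_pos_nonneg divide_simps)
    have tl: "\<bar>t * l\<bar> + t = 1/2" using t by (simp add: abs_mult algebra_simps)
    let ?x = "a + (1/2::real) *\<^sub>R (b - a)"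
    have x: "?x \<in> closed_segment a b"
    proof -
      have "a + s *\<^sub>R (b - a) = (1 - s) *\<^sub>R a + s *\<^sub>R b" for s :: real
        by (simp add: algebra_simps)
      then show ?thesis unfolding in_segment by (intro exI[of _ "1/2"]) simp
    qed
    have "?x + (t * norm w) *\<^sub>R ?u = a + (1/2 - t * l) *\<^sub>R (b - a) + t *\<^sub>R (c - a)"
      using w0 unfolding wl by (simp add: algebra_simps)
    moreover have "0 \<le> 1/2 - t * l" "1/2 - t * l + t \<le> 1" using tl t by (auto simp: abs_if split: if_splits)
    ultimately have "?x + (t * norm w) *\<^sub>R ?u \<in> convex hull {a, b, c}"
      unfolding hull using t by force
    moreover have "orthogonal ?u (x - y)" if "x \<in> closed_segment a b" "y \<in> closed_segment a b" for x y
    proof -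
      from seg[OF that(1)] seg[OF that(2)] obtain s r where "x = a + s *\<^sub>R (b - a)" "y = a + r *\<^sub>R (b - a)"
        by blast
      then have "x - y = (s - r) *\<^sub>R (b - a)" by (simp add: scaleR_left_diff_distrib)
      then show ?thesis using orth by (simp add: orthogonal_def)
    qed
    moreover have "norm ?u = 1" "t * norm w > 0" using w0 t by auto
    ultimately show "norm ?u = 1 \<and> (\<forall>x\<in>closed_segment a b. \<forall>y\<in>closed_segment a b. orthogonal ?u (x - y)) \<and>
       (\<exists>x\<in>closed_segment a b. \<exists>t>0. x + t *\<^sub>R ?u \<in> convex hull {a, b, c})"
      using x by blast
  next
    fix u assume u: "norm u = 1 \<and> (\<forall>x\<in>closed_segment a b. \<forall>y\<in>closed_segment a b. orthogonal u (x - y)) \<and>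
       (\<exists>x\<in>closed_segment a b. \<exists>t>0. x + t *\<^sub>R u \<in> convex hull {a, b, c})"
    then have ub: "u \<bullet> (b - a) = 0" by (auto simp: orthogonal_def)
    from u obtain x t where "x \<in> closed_segment a b" and t: "t > 0" and xt: "x + t *\<^sub>R u \<in> convex hull {a, b, c}"
      by blast
    then obtain s where s: "x = a + s *\<^sub>R (b - a)" using seg by blast
    from xt obtain p q where pq: "x + t *\<^sub>R u = a + p *\<^sub>R (b - a) + q *\<^sub>R (c - a)" "0 \<le> q"
      unfolding hull by blast
    define k where "k = p + q * l - s"
    have e: "t *\<^sub>R u = q *\<^sub>R w + k *\<^sub>R (b - a)"
      using pq(1) unfolding s wl k_def by (simp add: algebra_simps)
    have "(t *\<^sub>R u) \<bullet> (b - a) = k * ((b - a) \<bullet> (b - a))"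
      unfolding e by (simp add: inner_add_left orth)
    then have "k = 0" using ub ab by (simp add: inner_scaleR_left)
    then have e: "t *\<^sub>R u = q *\<^sub>R w" using e by simp
    then have "norm (t *\<^sub>R u) = norm (q *\<^sub>R w)" by simp
    then have tq: "t = q * norm w" using u t pq(2) by simp
    then have "q > 0" using t pq(2) by (cases "q = 0") auto
    have "q *\<^sub>R (norm w *\<^sub>R u) = q *\<^sub>R w" using e tq by simp
    then have "norm w *\<^sub>R u = w" using \<open>q > 0\<close> by (simp del: scaleR_scaleR)
    then have "inverse (norm w) *\<^sub>R (norm w *\<^sub>R u) = ?u" by (rule arg_cong)
    then show "u = ?u" using w0 by simp
  qed
qed

end

theory Submission
  imports Defs
begin

text \<open>
  Write the orthogonal projection of the apex \<open>d\<close> to the plane of \<open>F = abc\<close> in barycentric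
  coordinates as \<open>p = \<alpha> a + \<beta> b + \<gamma> c\<close>. If \<open>w\<close> and \<open>w'\<close> are the altitude vectors of \<open>c\<close> and \<open>d\<close>
  over the line \<open>ab\<close>, then \<open>w \<bullet> w' = w \<bullet> (p - a) = \<gamma> (w \<bullet> w)\<close>, so the dihedral angle at \<open>ab\<close> is
  not obtuse iff \<open>\<gamma> \<ge> 0\<close>. All three angles at \<open>F\<close> are thus not obtuse iff \<open>p \<in> F\<close>, and
  since the projection is affine and fixes \<open>F\<close>, this means that it maps \<open>T\<close> into \<open>F\<close>.
\<close>

section \<open>Altitude vectors and inward normals over a common edge\<close>

text \<open>Vanishing would put \<open>c\<close> on the line through \<open>a\<close> and
  \<open>b\<close>. With \<open>l\<close> arbitrary, this covers altitude vectors and also the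
  linear independence of \<open>b - a\<close> and \<open>c - a\<close>.\<close>

lemma altitude_nonzero:
  fixes a b c :: "'a::real_vector"
  assumes "\<not> collinear {a, b, c}"
  shows "(c - a) - l *\<^sub>R (b - a) \<noteq> 0"
proof
  assume "(c - a) - l *\<^sub>R (b - a) = 0"
  then have "c = (1 - l) *\<^sub>R a + l *\<^sub>R b" by (simp add: algebra_simps)
  then have "c \<in> affine hull {a, b}"
    unfolding affine_hull_2 by force
  moreover have "a \<noteq> b" using assms by auto
  ultimately show False
    using assms collinear_3_affine_hull by blast
qed

lemma inward_normal_inner_nonneg_iff:
  fixes a b c d :: "real ^ 3"
  assumes nc: "\<not> collinear {a, b, c}" and nd: "\<not> collinear {a, b, d}"
    and p: "p = \<alpha> *\<^sub>R a + \<beta> *\<^sub>R b + \<gamma> *\<^sub>R c" "\<alpha> + \<beta> + \<gamma> = 1"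
    and orth: "(d - p) \<bullet> (b - a) = 0" "(d - p) \<bullet> (c - a) = 0"
  shows "0 \<le> inward_normal (convex hull {a, b, c}) (closed_segment a b)
               \<bullet> inward_normal (convex hull {a, b, d}) (closed_segment a b) \<longleftrightarrow> 0 \<le> \<gamma>"
proof -
  define l where "l = ((c - a) \<bullet> (b - a)) / ((b - a) \<bullet> (b - a))"
  define m where "m = ((d - a) \<bullet> (b - a)) / ((b - a) \<bullet> (b - a))"
  define w where "w = (c - a) - l *\<^sub>R (b - a)"
  define w' where "w' = (d - a) - m *\<^sub>R (b - a)"
  have "a \<noteq> b" using nc by auto
  then have wb: "w \<bullet> (b - a) = 0"
    by (simp add: w_def l_def inner_diff_left[of "c - a" "_ *\<^sub>R (b - a)"])
  have wc: "w \<bullet> (c - a) = w \<bullet> w"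
  proof -
    have "c - a = w + l *\<^sub>R (b - a)" by (simp add: w_def)
    then show ?thesis using wb by (metis add.right_neutral inner_add_right inner_scaleR_right mult_zero_right)
  qed
  have "w \<bullet> (d - p) = (d - p) \<bullet> (c - a) - l * ((d - p) \<bullet> (b - a))"
    by (simp add: w_def inner_commute[of _ "d - p"] inner_diff_right[of _ "c - a"])
  then have wdp: "w \<bullet> (d - p) = 0" using orth by simp
  have \<alpha>: "\<alpha> = 1 - \<beta> - \<gamma>" using p(2) by simp
  have pa: "p - a = \<beta> *\<^sub>R (b - a) + \<gamma> *\<^sub>R (c - a)"
    unfolding p(1) \<alpha> by (simp add: algebra_simps)
  \<comment> \<open>Pass from \<open>a\<close> to \<open>d\<close> through the foot
    \<open>p\<close>: \<open>w\<close> is orthogonal to \<open>d - p\<close> and to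
    \<open>b - a\<close>, so only the part along \<open>c - a\<close>, with coefficient
    \<open>\<gamma>\<close>, survives.\<close>
  have "w' = (d - p) + (p - a) - m *\<^sub>R (b - a)"
    by (simp add: w'_def)
  then have "w' = (d - p) + (\<beta> *\<^sub>R (b - a) + \<gamma> *\<^sub>R (c - a)) - m *\<^sub>R (b - a)"
    by (simp only: pa)
  then have ww': "w \<bullet> w' = \<gamma> * (w \<bullet> w)"
    by (simp only: inner_add_right[of w] inner_diff_right[of w _ "m *\<^sub>R (b - a)"]
        inner_scaleR_right wb wc wdp)
  have pos: "norm w > 0" "norm w' > 0"
    using altitude_nonzero[OF nc] altitude_nonzero[OF nd] by (simp_all only: w_def w'_def zero_less_norm_iff not_False_eq_True)
  have "(w /\<^sub>R norm w) \<bullet> (w' /\<^sub>R norm w') = \<gamma> * norm w / norm w'"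
    using pos by (simp add: ww' power2_norm_eq_inner[symmetric] power2_eq_square divide_simps)
  then show ?thesis
    using pos inward_normal_triangle[OF nc w_def[unfolded l_def]]
      inward_normal_triangle[OF nd w'_def[unfolded m_def]]
    by (simp add: zero_le_divide_iff zero_le_mult_iff)
qed

lemma norm_inward_normal_triangle:
  fixes a b c :: "real ^ 3"
  assumes "\<not> collinear {a, b, c}"
  shows "norm (inward_normal (convex hull {a, b, c}) (closed_segment a b)) = 1"
  using inward_normal_triangle[OF assms refl] altitude_nonzero[OF assms]
  by simp

section \<open>Dihedral angles of a tetrahedron\<close>

text \<open>On [-1, 1], \<open>arccos\<close> is decreasing and takes the value pi/2 at 0.\<close>

lemma not_obtuse_arccos_iff:
  assumes "\<bar>x\<bar> \<le> 1"
  shows "\<not> obtuse (arccos x) \<longleftrightarrow> 0 \<le> x"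
  using arccos_le_mono[of x 0] assms by (simp add: obtuse_def not_less)

text \<open>A facet of a simplex omits exactly one vertex; it contains the edge \<open>ab\<close>
  iff that vertex is neither \<open>a\<close> nor \<open>b\<close>.\<close>

lemma facet_of_tetrahedron_superset_edge_iff:
  fixes a b c d :: "'a::euclidean_space"
  assumes dist: "distinct [a, b, c, d]" and ind: "\<not> affine_dependent {a, b, c, d}"
  shows "G facet_of convex hull {a, b, c, d} \<and> closed_segment a b \<subseteq> G \<longleftrightarrow>
         G = convex hull {a, b, c} \<or> G = convex hull {a, b, d}"
proof -
  let ?S = "{a, b, c, d}"
  have notin: "u \<notin> convex hull (?S - {u})" if "u \<in> ?S" for u
    using that ind convex_hull_subset_affine_hull unfolding affine_dependent_def by blast
  have rem: "?S - {c} = {a, b, d}" "?S - {d} = {a, b, c}"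
    using dist by auto
  have sub: "closed_segment a b \<subseteq> convex hull A" if "a \<in> A" "b \<in> A" for A
    using that by (simp add: segment_convex_hull hull_mono)
  show ?thesis
  proof
    assume "G facet_of convex hull ?S \<and> closed_segment a b \<subseteq> G"
    then obtain u where u: "u \<in> ?S" "G = convex hull (?S - {u})" "closed_segment a b \<subseteq> G"
      using facet_of_convex_hull_affine_independent[OF ind] by blast
    \<comment> \<open>If an endpoint of the edge were omitted, it would still lie in the hull of the
      other vertices, against affine independence.\<close>
    then have "u \<noteq> a" "u \<noteq> b" using notin[OF u(1)] by auto
    then show "G = convex hull {a, b, c} \<or> G = convex hull {a, b, d}"
      using u rem by auto
  next
    assume G: "G = convex hull {a, b, c} \<or> G = convex hull {a, b, d}"
    then have "G \<noteq> {}" by (metis convex_hull_eq_empty insert_not_empty)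
    with G have "G facet_of convex hull ?S"
      using rem facet_of_convex_hull_affine_independent[OF ind, of G] by auto
    then show "G facet_of convex hull ?S \<and> closed_segment a b \<subseteq> G"
      using G sub by auto
  qed
qed

text \<open>The description in \<open>dihedral_angle\<close> is well defined: the two facets at the
  edge are determined up to order, and the inner product is symmetric.\<close>

lemma dihedral_angle_tetrahedron:
  fixes a b c d :: "real ^ 3"
  assumes dist: "distinct [a, b, c, d]" and ind: "\<not> affine_dependent {a, b, c, d}"
  shows "dihedral_angle (convex hull {a, b, c, d}) (closed_segment a b) =
         arccos (inward_normal (convex hull {a, b, c}) (closed_segment a b)
                 \<bullet> inward_normal (convex hull {a, b, d}) (closed_segment a b))"
proof -
  have "c \<notin> affine hull {a, b, d}"
    using ind dist unfolding affine_dependent_def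
    by (auto simp: insert_Diff_if split: if_splits)
  then have "c \<notin> convex hull {a, b, d}"
    using convex_hull_subset_affine_hull by blast
  then have ne: "convex hull {a, b, c} \<noteq> convex hull {a, b, d}"
    by (metis hull_inc insertCI)
  note iff = facet_of_tetrahedron_superset_edge_iff[OF dist ind]
  show ?thesis
    unfolding dihedral_angle_def
  proof (rule the_equality, goal_cases)
    case 1
    show ?case
      using iff[of "convex hull {a, b, c}"] iff[of "convex hull {a, b, d}"] ne by blast
  next
    case (2 \<theta>)
    then show ?case
      using iff by (metis inner_commute)
  qed
qed

lemma not_collinear_of_affine_independent:
  assumes "distinct [a, b, c]" and "\<not> affine_dependent S" and "{a, b, c} \<subseteq> S"
  shows "\<not> collinear {a, b, c}"
  using assms affine_dependent_subset collinear_3_eq_affine_dependent by fastforce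

text \<open>The edge \<open>ab\<close> is tested by the coordinate of the opposite base vertex
  \<open>c\<close>. Both triangles at the edge are nondegenerate, so the normals are unit vectors
  and Cauchy-Schwarz puts their inner product in the domain of \<open>arccos\<close>.\<close>

lemma not_obtuse_dihedral_angle_iff:
  fixes a b c d :: "real ^ 3"
  assumes dist: "distinct [a, b, c, d]" and ind: "\<not> affine_dependent {a, b, c, d}"
    and p: "p = \<alpha> *\<^sub>R a + \<beta> *\<^sub>R b + \<gamma> *\<^sub>R c" "\<alpha> + \<beta> + \<gamma> = 1"
    and orth: "(d - p) \<bullet> (b - a) = 0" "(d - p) \<bullet> (c - a) = 0"
  shows "\<not> obtuse (dihedral_angle (convex hull {a, b, c, d}) (closed_segment a b)) \<longleftrightarrow> 0 \<le> \<gamma>"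
proof -
  have nc: "\<not> collinear {a, b, c}" "\<not> collinear {a, b, d}"
    using dist not_collinear_of_affine_independent[OF _ ind, of a b c]
      not_collinear_of_affine_independent[OF _ ind, of a b d] by simp_all
  have "\<bar>inward_normal (convex hull {a, b, c}) (closed_segment a b)
         \<bullet> inward_normal (convex hull {a, b, d}) (closed_segment a b)\<bar> \<le> 1"
    using Cauchy_Schwarz_ineq2 norm_inward_normal_triangle nc by (metis mult_1)
  then show ?thesis
    using inward_normal_inner_nonneg_iff[OF nc p orth]
    by (simp add: dihedral_angle_tetrahedron[OF dist ind] not_obtuse_arccos_iff)
qed

section \<open>Orthogonal projection to the base plane\<close>

text \<open>Every point of the tetrahedron is a convex combination of \<open>d\<close> and a point
  \<open>y\<close> of the base; its projection is the same combination of \<open>p\<close> and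
  \<open>y\<close>. Conversely, \<open>p\<close> is itself the image of \<open>d\<close>.\<close>

lemma orth_proj_image_tetrahedron_subset_iff:
  fixes a b c d p :: "'a::euclidean_space"
  assumes p: "p \<in> affine hull {a, b, c}"
    and orth: "\<And>u v. u \<in> affine hull {a, b, c} \<Longrightarrow> v \<in> affine hull {a, b, c} \<Longrightarrow> orthogonal (d - p) (u - v)"
  shows "orth_proj (affine hull {a, b, c}) ` (convex hull {a, b, c, d}) \<subseteq> convex hull {a, b, c} \<longleftrightarrow>
         p \<in> convex hull {a, b, c}"
proof -
  let ?A = "affine hull {a, b, c}" and ?F = "convex hull {a, b, c}"
  have "orth_proj ?A d = p"
    using orth_proj_unique p orth by blast
  moreover have "d \<in> convex hull {a, b, c, d}"
    by (simp add: hull_inc)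
  ultimately have "p \<in> ?F" if "orth_proj ?A ` (convex hull {a, b, c, d}) \<subseteq> ?F"
    using that by blast
  moreover have "orth_proj ?A x \<in> ?F" if pF: "p \<in> ?F" and x: "x \<in> convex hull {a, b, c, d}" for x
  proof -
    have "x \<in> convex hull (insert d {a, b, c})"
      using x by (simp add: insert_commute)
    then obtain s t y where st: "0 \<le> s" "0 \<le> t" "s + t = 1" and y: "y \<in> ?F" and x: "x = s *\<^sub>R d + t *\<^sub>R y"
      unfolding convex_hull_insert[of "{a, b, c}" d, simplified] by auto
    let ?z = "s *\<^sub>R p + t *\<^sub>R y"
    have z: "?z \<in> ?F"
      using st y pF by (intro convexD) auto
    \<comment> \<open>A multiple of \<open>d - p\<close> is orthogonal to the plane, so
      \<open>orth_proj_unique\<close> identifies \<open>?z\<close> as the projection of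
      \<open>x\<close>.\<close>
    have "x - ?z = s *\<^sub>R (d - p)"
      by (simp add: x algebra_simps)
    then have "orth_proj ?A x = ?z"
      using z orth convex_hull_subset_affine_hull[of "{a, b, c}"]
      by (intro orth_proj_unique) (auto simp: orthogonal_clauses)
    with z show ?thesis by simp
  qed
  ultimately show ?thesis by blast
qed

text \<open>Translate \<open>A\<close> to its direction subspace and decompose \<open>x - a\<close>
  there. This supplies the candidate that \<open>orth_proj_unique\<close> asks for.\<close>

lemma orth_proj_exists:
  fixes A :: "'a::euclidean_space set"
  assumes "affine A" "A \<noteq> {}"
  obtains y where "y \<in> A" "\<And>u v. u \<in> A \<Longrightarrow> v \<in> A \<Longrightarrow> orthogonal (x - y) (u - v)"
proof -
  obtain a where a: "a \<in> A" using assms by blast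
  let ?S = "(\<lambda>v. v - a) ` A"
  have S: "subspace ?S"
    using affine_diffs_subspace_subtract[OF assms(1) a] by (simp add: image_def)
  obtain y z where yz: "y \<in> span ?S" "\<And>w. w \<in> span ?S \<Longrightarrow> orthogonal z w" "x - a = y + z"
    using orthogonal_subspace_decomp_exists[of ?S "x - a"] by metis
  have span: "span ?S = ?S" using S by simp
  show ?thesis
  proof
    show "a + y \<in> A" using yz(1) span by auto
    fix u v assume "u \<in> A" "v \<in> A"
    then have "(u - a) - (v - a) \<in> span ?S" by (intro span_diff span_base) auto
    then have "orthogonal z (u - v)" using yz(2) by simp
    moreover have "x - (a + y) = z" using yz(3) by (simp add: algebra_simps)
    ultimately show "orthogonal (x - (a + y)) (u - v)" by simp
  qed
qed

section \<open>Barycentric coordinates and edges of a triangle\<close>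

text \<open>Barycentric coordinates are unique for a nondegenerate triangle, so they agree with the
  nonnegative weights of any convex combination.\<close>

lemma barycentric_mem_convex_hull_3_iff:
  fixes a b c :: "'a::euclidean_space"
  assumes nc: "\<not> collinear {a, b, c}" and sum: "\<alpha> + \<beta> + \<gamma> = 1"
  shows "\<alpha> *\<^sub>R a + \<beta> *\<^sub>R b + \<gamma> *\<^sub>R c \<in> convex hull {a, b, c} \<longleftrightarrow> 0 \<le> \<alpha> \<and> 0 \<le> \<beta> \<and> 0 \<le> \<gamma>"
proof
  assume "\<alpha> *\<^sub>R a + \<beta> *\<^sub>R b + \<gamma> *\<^sub>R c \<in> convex hull {a, b, c}"
  then obtain u v w where uvw: "0 \<le> u" "0 \<le> v" "0 \<le> w" "u + v + w = 1"
    and eq: "\<alpha> *\<^sub>R a + \<beta> *\<^sub>R b + \<gamma> *\<^sub>R c = u *\<^sub>R a + v *\<^sub>R b + w *\<^sub>R c"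
    unfolding convex_hull_3 by auto
  \<comment> \<open>Eliminating the weights of \<open>a\<close> turns the equality of points into a
    linear relation between \<open>b - a\<close> and \<open>c - a\<close>.\<close>
  have "\<alpha> = 1 - \<beta> - \<gamma>" "u = 1 - v - w" using sum uvw by auto
  with eq have lin: "(\<gamma> - w) *\<^sub>R (c - a) = (v - \<beta>) *\<^sub>R (b - a)"
    by (simp add: algebra_simps)
  have "\<gamma> = w"
  proof (rule ccontr)
    assume ne: "\<gamma> \<noteq> w"
    have "c - a = inverse (\<gamma> - w) *\<^sub>R ((\<gamma> - w) *\<^sub>R (c - a))"
      using ne by simp
    also have "\<dots> = ((v - \<beta>) / (\<gamma> - w)) *\<^sub>R (b - a)"
      unfolding lin by (simp add: divide_inverse mult.commute)
    finally show False
      using altitude_nonzero[OF nc, of "(v - \<beta>) / (\<gamma> - w)"] by simp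
  qed
  moreover have "a \<noteq> b" using nc by auto
  ultimately have "\<beta> = v" using lin by simp
  with \<open>\<gamma> = w\<close> uvw sum show "0 \<le> \<alpha> \<and> 0 \<le> \<beta> \<and> 0 \<le> \<gamma>" by simp
next
  assume "0 \<le> \<alpha> \<and> 0 \<le> \<beta> \<and> 0 \<le> \<gamma>"
  then show "\<alpha> *\<^sub>R a + \<beta> *\<^sub>R b + \<gamma> *\<^sub>R c \<in> convex hull {a, b, c}"
    using sum unfolding convex_hull_3 by blast
qed

text \<open>A triangle has dimension 2, so its edges are its facets, each spanned by two of the
  three vertices.\<close>

lemma edges_of_triangle:
  fixes a b c :: "'a::euclidean_space"
  assumes nc: "\<not> collinear {a, b, c}"
  shows "{e. e edge_of convex hull {a, b, c}} = {closed_segment a b, closed_segment b c, closed_segment c a}"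
proof -
  have dist: "a \<noteq> b" "b \<noteq> c" "c \<noteq> a" using nc by (auto simp: insert_commute)
  have ind: "\<not> affine_dependent {a, b, c}"
    using nc collinear_3_eq_affine_dependent by blast
  have rem: "{a, b, c} - {a} = {b, c}" "{a, b, c} - {b} = {c, a}" "{a, b, c} - {c} = {a, b}"
    using dist by auto
  have "aff_dim (convex hull {a, b, c}) = 2"
    using dist aff_dim_affine_independent[OF ind] by (simp add: aff_dim_convex_hull)
  then have "e edge_of convex hull {a, b, c} \<longleftrightarrow> e facet_of convex hull {a, b, c}" for e
    by (auto simp: edge_of_def facet_of_def)
  moreover have "e facet_of convex hull {a, b, c} \<longleftrightarrow> e \<noteq> {} \<and>
      (e = convex hull ({a, b, c} - {a}) \<or> e = convex hull ({a, b, c} - {b}) \<or>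
       e = convex hull ({a, b, c} - {c}))" for e
    using facet_of_convex_hull_affine_independent[OF ind, of e] by blast
  ultimately have iff: "e edge_of convex hull {a, b, c} \<longleftrightarrow> e \<noteq> {} \<and>
      (e = closed_segment b c \<or> e = closed_segment c a \<or> e = closed_segment a b)" for e
    by (simp only: rem segment_convex_hull)
  have "closed_segment x y \<noteq> {}" for x y :: 'a by simp
  with iff show ?thesis by blast
qed

theorem lemma4p3:
  fixes T F e1 e2 e3 :: "(real ^ 3) set"
  assumes "3 simplex T"
    and "F facet_of T"
    and "{e. e edge_of F} = {e1, e2, e3}"
  shows "is_height_function T F \<longleftrightarrow>
         \<not> obtuse (dihedral_angle T e1) \<and> \<not> obtuse (dihedral_angle T e2) \<and> \<not> obtuse (dihedral_angle T e3)"
proof -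
  obtain S where S: "\<not> affine_dependent S" "card S = 4" "T = convex hull S"
    using assms(1) by (auto simp: simplex_def)
  \<comment> \<open>The apex \<open>d\<close> is the vertex opposite the foundation.\<close>
  obtain d where d: "d \<in> S" "F = convex hull (S - {d})"
    using assms(2) facet_of_convex_hull_affine_independent[OF S(1)] S(3) by blast
  have "card (S - {d}) = 3" using S(2) d(1) by simp
  then obtain a b c where abc: "S - {d} = {a, b, c}" "a \<noteq> b" "b \<noteq> c" "a \<noteq> c"
    by (auto simp: card_3_iff)
  have S_eq: "S = {a, b, c, d}" using abc d(1) by auto
  have "d \<notin> {a, b, c}" using abc(1) by blast
  then have dist: "distinct [a, b, c, d]" using abc by auto
  have ind: "\<not> affine_dependent {a, b, c, d}" using S(1) S_eq by simp
  have T: "T = convex hull {a, b, c, d}" and F: "F = convex hull {a, b, c}"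
    using S(3) S_eq d(2) abc(1) by auto
  have nc: "\<not> collinear {a, b, c}"
    using dist not_collinear_of_affine_independent[OF _ ind, of a b c] by simp
  obtain p where p: "p \<in> affine hull {a, b, c}"
    "\<And>u v. u \<in> affine hull {a, b, c} \<Longrightarrow> v \<in> affine hull {a, b, c} \<Longrightarrow> orthogonal (d - p) (u - v)"
    using orth_proj_exists[of "affine hull {a, b, c}" d] by auto
  obtain \<alpha> \<beta> \<gamma> where bary: "p = \<alpha> *\<^sub>R a + \<beta> *\<^sub>R b + \<gamma> *\<^sub>R c" "\<alpha> + \<beta> + \<gamma> = 1"
    using p(1) unfolding affine_hull_3 by auto
  have orth: "(d - p) \<bullet> (x - y) = 0" if "x \<in> {a, b, c}" "y \<in> {a, b, c}" for x y
    using that p(2) hull_inc unfolding orthogonal_def by metis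
  have "is_height_function T F \<longleftrightarrow> 0 \<le> \<alpha> \<and> 0 \<le> \<beta> \<and> 0 \<le> \<gamma>"
    using assms(2) orth_proj_image_tetrahedron_subset_iff[OF p]
      barycentric_mem_convex_hull_3_iff[OF nc bary(2)] bary(1)
    by (simp add: is_height_function_def T F)
  moreover have "\<not> obtuse (dihedral_angle T (closed_segment a b)) \<longleftrightarrow> 0 \<le> \<gamma>"
    unfolding T by (rule not_obtuse_dihedral_angle_iff[OF dist ind bary]) (auto intro: orth)
  \<comment> \<open>Rotating the base vertices cyclically makes \<open>a\<close> the vertex opposite
    the edge, so \<open>\<alpha>\<close> takes over the role of \<open>\<gamma>\<close>; the edge
    \<open>ca\<close> is treated in the same way.\<close>
  moreover have "\<not> obtuse (dihedral_angle T (closed_segment b c)) \<longleftrightarrow> 0 \<le> \<alpha>"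
  proof -
    have eq: "{b, c, a, d} = {a, b, c, d}" by auto
    have "\<not> obtuse (dihedral_angle (convex hull {b, c, a, d}) (closed_segment b c)) \<longleftrightarrow> 0 \<le> \<alpha>"
      by (rule not_obtuse_dihedral_angle_iff[of b c a d p \<beta> \<gamma> \<alpha>])
        (use dist ind bary(2) in \<open>auto simp: eq bary(1) orth[unfolded bary(1)]\<close>)
    then show ?thesis by (simp only: T eq)
  qed
  moreover have "\<not> obtuse (dihedral_angle T (closed_segment c a)) \<longleftrightarrow> 0 \<le> \<beta>"
  proof -
    have eq: "{c, a, b, d} = {a, b, c, d}" by auto
    have "\<not> obtuse (dihedral_angle (convex hull {c, a, b, d}) (closed_segment c a)) \<longleftrightarrow> 0 \<le> \<beta>"
      by (rule not_obtuse_dihedral_angle_iff[of c a b d p \<gamma> \<alpha> \<beta>])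
        (use dist ind bary(2) in \<open>auto simp: eq bary(1) orth[unfolded bary(1)]\<close>)
    then show ?thesis by (simp only: T eq)
  qed
  \<comment> \<open>The edges are given only as a set; quantifying over it avoids matching
    \<open>e1\<close>, \<open>e2\<close>, \<open>e3\<close> with particular segments.\<close>
  moreover have "(\<not> obtuse (dihedral_angle T e1) \<and> \<not> obtuse (dihedral_angle T e2) \<and> \<not> obtuse (dihedral_angle T e3))
      \<longleftrightarrow> (\<forall>e\<in>{closed_segment a b, closed_segment b c, closed_segment c a}. \<not> obtuse (dihedral_angle T e))"
    using assms(3) unfolding F edges_of_triangle[OF nc] by simp
  ultimately show ?thesis by auto
qed

end
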